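(* Let $a=\{a_n\}_{n\ge1}$ be a non-increasing, summable sequence of positive real numbers, and let $W_a$ denote the class of all non-increasing, summable sequences of positive real numbers that are weak tail-equivalent to $a$. For a sequence $b\in W_a$ let $h_b$ denote the dimension function associated to $b$. The following are equivalent: (1) there exists $b\in W_a$ such that $h_b^{-1}$ is doubling; (2) for every $b\in W_a$, $h_b^{-1}$ is doubling; (3) every $b\in W_a$ is tail-equivalent to $a$.
   Context: A function $h$ on an interval $(0,A]$ is increasing if $h(x)<h(y)$ whenever $x<y$, and doubling if there is $\tau>0$ with $h(x)\ge\tau h(2x)$ for all $x$ with $x,2x$ in the domain. A dimension function is a continuous, increasing, doubling function $h:(0,A]\to(0,\infty)$ (for some $A>0$, which may depend on $h$) with $h(x)\to0$ as $x\to0^+$. Its inverse $h^{-1}$ is defined on $(0,h(A)]$. $f\preceq h$ means there is $c>0$ with $f(x)\le c\,h(x)$ for all $x$ (in the common domain); $f\equiv h$ means $f\preceq h$ and $h\preceq f$. Positive sequences $x,y$ are equivalent if there are $c_1,c_2>0$ with $c_1\le x_n/y_n\le c_2$ for all $n$. For a positive, non-increasing, summable sequence $a$, the tails are $r_n^{(a)}=\sum_{j\ge n}a_j$. An increasing continuous $h:(0,A]\to(0,\infty)$ is associated to $a$ if the sequence $\{h(r_n^{(a)}/n)\}$ (over those $n$ with $r_n^{(a)}/n\le A$) is equivalent to $\{1/n\}$. Every function associated to $a$ is a dimension function, and any two are equivalent ($\equiv$), so one speaks of "the" associated dimension function $h_a$ (whether $h_a^{-1}$ is doubling does not depend on the choice).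 Sequences $a,b$ are tail-equivalent if the sequences $\{r_n^{(a)}\}$ and $\{r_n^{(b)}\}$ are equivalent. They are weak tail-equivalent if there are positive integers $j,k$ such that $r_n^{(a)}\ge r_{jn}^{(b)}/j$ and $r_n^{(b)}\ge r_{kn}^{(a)}/k$ for all $n\ge1$. *)

theory Defs
  imports "HOL-Analysis.Analysis"
begin

text \<open>Sequences are indexed by the positive integers; the value at index 0 is never used.\<close>

definition admissible :: "(nat \<Rightarrow> real) \<Rightarrow> bool" where
  "admissible a \<longleftrightarrow> (\<forall>n\<ge>1. a n > 0) \<and> (\<forall>n\<ge>1. a (Suc n) \<le> a n) \<and> summable a"

definition tail :: "(nat \<Rightarrow> real) \<Rightarrow> nat \<Rightarrow> real" where
  "tail a n = (\<Sum>j. a (n + j))"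

definition seq_equiv_on :: "nat set \<Rightarrow> (nat \<Rightarrow> real) \<Rightarrow> (nat \<Rightarrow> real) \<Rightarrow> bool" where
  "seq_equiv_on N x y \<longleftrightarrow> (\<exists>c1>0. \<exists>c2>0. \<forall>n\<in>N. c1 \<le> x n / y n \<and> x n / y n \<le> c2)"

definition tail_equivalent :: "(nat \<Rightarrow> real) \<Rightarrow> (nat \<Rightarrow> real) \<Rightarrow> bool" where
  "tail_equivalent a b \<longleftrightarrow> seq_equiv_on {1..} (tail a) (tail b)"

definition weak_tail_equivalent :: "(nat \<Rightarrow> real) \<Rightarrow> (nat \<Rightarrow> real) \<Rightarrow> bool" where
  "weak_tail_equivalent a b \<longleftrightarrow>
     (\<exists>j\<ge>1. \<exists>k\<ge>1. \<forall>n\<ge>1. tail a n \<ge> tail b (j * n) / real j \<and> tail b n \<ge> tail a (k * n) / real k)"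

definition weak_tail_class :: "(nat \<Rightarrow> real) \<Rightarrow> (nat \<Rightarrow> real) set" where
  "weak_tail_class a = {b. admissible b \<and> weak_tail_equivalent b a}"

text \<open>A function on the interval \<open>(0, A]\<close> is represented by the pair of \<open>A\<close> and a total function,
  of which only the restriction to \<open>{0<..A}\<close> matters.\<close>

definition doubling :: "real \<Rightarrow> (real \<Rightarrow> real) \<Rightarrow> bool" where
  "doubling A f \<longleftrightarrow> (\<exists>\<tau>>0. \<forall>x. x \<in> {0<..A} \<and> 2 * x \<in> {0<..A} \<longrightarrow> f x \<ge> \<tau> * f (2 * x))"

text \<open>The limit 0 at 0 and the doubling property of a dimension function are not required here:
  they follow from the other conditions.\<close>

definition associated :: "(nat \<Rightarrow> real) \<Rightarrow> real \<Rightarrow> (real \<Rightarrow> real) \<Rightarrow> bool" where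
  "associated a A h \<longleftrightarrow>
     A > 0 \<and> h ` {0<..A} \<subseteq> {0<..} \<and> strict_mono_on {0<..A} h \<and> continuous_on {0<..A} h \<and>
     seq_equiv_on {n. n \<ge> 1 \<and> tail a n / real n \<le> A} (\<lambda>n. h (tail a n / real n)) (\<lambda>n. 1 / real n)"

text \<open>For \<open>h\<close> associated to a sequence, \<open>h\<close> maps \<open>(0, A]\<close> bijectively onto \<open>(0, h A]\<close>.\<close>

definition inverse_doubling :: "real \<Rightarrow> (real \<Rightarrow> real) \<Rightarrow> bool" where
  "inverse_doubling A h \<longleftrightarrow> doubling (h A) (the_inv_into {0<..A} h)"

text \<open>Every admissible sequence has an associated function, so a choice \<open>b \<mapsto> (A b, h b)\<close> of
  associated functions always exists.\<close>

lemma tail_pos: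
  assumes "admissible a" "n \<ge> 1" shows "tail a n > 0"
proof -
  have "summable (\<lambda>j. a (n + j))"
    using assms summable_ignore_initial_segment[of a n] by (simp add: admissible_def add.commute)
  then show ?thesis
    unfolding tail_def using assms by (intro suminf_pos) (auto simp: admissible_def)
qed

lemma tail_antimono:
  assumes "admissible a" "1 \<le> m" "m \<le> n" shows "tail a n \<le> tail a m"
  using assms(3)
proof (induction rule: dec_induct)
  case (step k)
  have "summable (\<lambda>j. a (k + j))"
    using assms summable_ignore_initial_segment[of a k] by (simp add: admissible_def add.commute)
  from suminf_split_head[OF this] have "tail a (Suc k) = tail a k - a k"
    by (simp add: tail_def)
  moreover have "a k > 0" using assms step by (auto simp: admissible_def)
  ultimately show ?case using step by simp
qed simp

lemma inverse_squares_tail: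
  fixes n :: nat
  assumes "n \<ge> 1"
  shows "summable (\<lambda>m. 1 / real (m + n)^2)" "1 / real n \<le> (\<Sum>m. 1 / real (m + n)^2)"
    "(\<Sum>m. 1 / real (m + n)^2) \<le> 2 / real n"
proof -
  let ?g = "\<lambda>m. 1 / real (m + n) - 1 / real (Suc m + n)"
  have "(\<lambda>m. 1 / real (m + n)) \<longlonglongrightarrow> 0"
    using LIMSEQ_ignore_initial_segment[OF lim_inverse_n', of n] by simp
  from telescope_sums'[OF this] have g: "?g sums (1 / real n)" by simp
  show s: "summable (\<lambda>m. 1 / real (m + n)^2)"
    using summable_ignore_initial_segment[OF inverse_power_summable[of 2, where 'a = real], of n]
    by (simp add: field_simps)
  have "?g m \<le> 1 / real (m + n)^2" for m
  proof -
    have "?g m = 1 / (real (m + n) * (real (m + n) + 1))"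
      using assms by (simp add: field_simps)
    also have "\<dots> \<le> 1 / (real (m + n) * real (m + n))"
      using assms by (intro divide_left_mono mult_left_mono mult_pos_pos) auto
    finally show ?thesis by (simp add: power2_eq_square)
  qed
  then have "(\<Sum>m. ?g m) \<le> (\<Sum>m. 1 / real (m + n)^2)"
    by (intro suminf_le s sums_summable[OF g])
  then show "1 / real n \<le> (\<Sum>m. 1 / real (m + n)^2)" using g sums_unique by fastforce
  have "1 / real (m + n)^2 \<le> 2 * ?g m" for m
  proof -
    have *: "2 * ?g m = 2 / (real (m + n) * (real (m + n) + 1))"
      using assms by (simp add: field_simps)
    have "1 / (real (m + n) * real (m + n)) = 2 / (real (m + n) * (2 * real (m + n)))"
      using assms by (simp add: divide_simps)
    also have "\<dots> \<le> 2 / (real (m + n) * (real (m + n) + 1))"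
      using assms by (intro divide_left_mono mult_left_mono mult_pos_pos) auto
    finally show ?thesis unfolding * by (simp add: power2_eq_square)
  qed
  then have "(\<Sum>m. 1 / real (m + n)^2) \<le> (\<Sum>m. 2 * ?g m)"
    by (intro suminf_le s summable_mult sums_summable[OF g])
  also have "\<dots> = 2 * (1 / real n)" using sums_mult[OF g, of 2] sums_unique by metis
  finally show "(\<Sum>m. 1 / real (m + n)^2) \<le> 2 / real n" by simp
qed

lemma associated_exists:
  assumes a: "admissible a"
  shows "\<exists>A h. associated a A h"
proof -
  define s where "s n = tail a n / real n" for n
  define t where "t = (\<lambda>x m. 1 / real (Suc m)^2 * min 1 ((x / s (Suc m))^2))"
  define h where "h x = (\<Sum>m. t x m)" for x
  have sp: "s (Suc n) > 0" for n using tail_pos[OF a, of "Suc n"] by (simp add: s_def)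
  have sq: "summable (\<lambda>m. 1 / real (Suc m)^2)" using inverse_squares_tail(1)[of 1] by simp
  have t0: "t x m \<ge> 0" for x m by (simp add: t_def)
  have tle: "t x m \<le> 1 / real (Suc m)^2" for x m
    using mult_left_mono[of "min 1 ((x / s (Suc m))^2)" 1 "1 / real (Suc m)^2"] by (simp add: t_def)
  have ts: "summable (t x)" for x
    by (rule summable_comparison_test'[OF sq, of 0]) (use t0 tle in \<open>simp add: abs_of_nonneg\<close>)
  have tpos: "t x m > 0" if "x > 0" for x m
    using that sp[of m] by (simp add: t_def min_def)
  have hpos: "h x > 0" if "x > 0" for x
    unfolding h_def by (intro suminf_pos ts tpos that)
  have tmono: "t x m \<le> t y m" if "0 < x" "x \<le> y" for x y m
    unfolding t_def using that sp[of m]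
    by (intro mult_left_mono min.mono power_mono divide_right_mono) auto
  have cont: "continuous_on UNIV h"
  proof -
    have "uniform_limit UNIV (\<lambda>n x. \<Sum>m<n. t x m) h sequentially"
      unfolding h_def
      by (rule Weierstrass_m_test[OF _ sq]) (use t0 tle in \<open>simp add: abs_of_nonneg\<close>)
    then show ?thesis
      by (rule uniform_limit_theorem[rotated]) (use less_imp_neq[OF sp] in \<open>auto intro!: always_eventually continuous_intros simp: t_def\<close>)
  qed
  have strict: "h x < h y" if "0 < x" "x < y" "y \<le> s 1" for x y
  proof -
    have s1: "s 1 > 0" using sp[of 0] by simp
    have "(x / s 1)^2 < (y / s 1)^2"
      using that s1 by (intro power_strict_mono divide_strict_right_mono) auto
    moreover have "(y / s 1)^2 \<le> 1"
      using that s1 by (intro power_le_one) auto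
    ultimately have "t x 0 < t y 0" by (simp add: t_def)
    then have "0 < (\<Sum>m. t y m - t x m)"
      using tmono that by (intro suminf_pos2[of _ 0] summable_diff ts) auto
    then show ?thesis by (simp add: h_def suminf_diff[OF ts ts, symmetric])
  qed
  have smono: "s n \<le> s m" if "1 \<le> m" "m \<le> n" for m n
    unfolding s_def using that tail_antimono[OF a that] tail_pos[OF a, of n]
    by (intro frac_le) auto
  have bounds: "1 / real n \<le> h (s n) \<and> h (s n) \<le> 3 / real n" if n: "n \<ge> 1" for n
  proof -
    obtain p where p: "n = Suc p" using n by (cases n) auto
    have split: "h (s n) = (\<Sum>m. t (s n) (m + p)) + (\<Sum>m<p. t (s n) m)"
      unfolding h_def by (rule suminf_split_initial_segment[OF ts])
    have "t (s n) (m + p) = 1 / real (m + n)^2" for m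
    proof -
      have "s (m + n) \<le> s n" "s (m + n) > 0" using smono[of n "m + n"] n sp[of "m + p"] p by auto
      then show ?thesis by (simp add: t_def p min_def power_le_one_iff field_simps)
    qed
    then have 1: "(\<Sum>m. t (s n) (m + p)) = (\<Sum>m. 1 / real (m + n)^2)" by simp
    have "t (s n) m \<le> 1 / real n ^ 2" if "m < p" for m
    proof -
      have "tail a n \<le> tail a (Suc m)" using that p by (intro tail_antimono[OF a]) auto
      then have "s n / s (Suc m) \<le> real (Suc m) / real n"
        using tail_pos[OF a, of "Suc m"] n
        by (simp add: s_def divide_simps mult_mono del: of_nat_Suc)
      moreover have "0 \<le> s n / s (Suc m)" using sp[of m] sp[of p] p by simp
      ultimately have "(s n / s (Suc m))^2 \<le> (real (Suc m) / real n)^2"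
        by (rule power_mono)
      then have "t (s n) m \<le> 1 / real (Suc m)^2 * (real (Suc m) / real n)^2"
        unfolding t_def by (intro mult_left_mono) (auto simp: min.coboundedI2)
      then show ?thesis by (simp add: power_divide del: of_nat_Suc)
    qed
    then have "(\<Sum>m<p. t (s n) m) \<le> real (card {..<p}) * (1 / real n ^ 2)"
      by (intro sum_bounded_above) auto
    also have "\<dots> \<le> real n * (1 / real n ^ 2)" using p by (intro mult_right_mono) auto
    also have "\<dots> = 1 / real n" by (simp add: power2_eq_square)
    finally have "(\<Sum>m<p. t (s n) m) \<le> 1 / real n" .
    moreover have "0 \<le> (\<Sum>m<p. t (s n) m)" by (intro sum_nonneg t0)
    ultimately show ?thesis using split 1 inverse_squares_tail(2,3)[OF n] by simp
  qed
  have "associated a (s 1) h"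
    unfolding associated_def seq_equiv_on_def
  proof (intro conjI)
    show "\<exists>c1>0. \<exists>c2>0. \<forall>n\<in>{n. 1 \<le> n \<and> tail a n / real n \<le> s 1}.
            c1 \<le> h (tail a n / real n) / (1 / real n) \<and> h (tail a n / real n) / (1 / real n) \<le> c2"
      by (rule exI[of _ 1], simp, rule exI[of _ 3])
         (use bounds in \<open>auto simp: s_def field_simps\<close>)
    show "continuous_on {0<..s 1} h" using cont continuous_on_subset by blast
    show "strict_mono_on {0<..s 1} h" by (auto intro!: strict_mono_onI strict)
  qed (use sp[of 0] hpos in auto)
  then show ?thesis by blast
qed

end

theory Submission imports Defs begin

text \<open>All three conditions say that the tails of \<open>a\<close> satisfy \<open>tail a (2 * n) \<ge> c * tail a n\<close>.
  Since \<open>h\<close> maps \<open>tail a n / n\<close> to about \<open>1 / n\<close>, this is the doubling property of the inverse of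
  \<open>h\<close>. It is invariant under weak tail-equivalence, as it absorbs the dilations of the index, and
  for the same reason it upgrades weak tail-equivalence to tail-equivalence. Conversely, the
  sequence \<open>n \<mapsto> a (2 * n) + a (2 * n + 1)\<close> has tails \<open>tail a (2 * n)\<close>, so it is always weak
  tail-equivalent to \<open>a\<close>, and it is tail-equivalent to \<open>a\<close> only if the tails of \<open>a\<close> are
  doubling.\<close>

section \<open>Doubling tails and weak tail-equivalence\<close>

definition tail_doubling :: "(nat \<Rightarrow> real) \<Rightarrow> bool" where
  "tail_doubling a \<longleftrightarrow> (\<exists>c>0. \<forall>n\<ge>1. c * tail a n \<le> tail a (2 * n))"

text \<open>Since \<open>K * n \<le> 2 ^ K * n\<close>, iterating the doubling bound
  \<open>K\<close> times gives the constant \<open>c ^ K\<close>; monotonicity of the tails then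
  covers every smaller \<open>m\<close>, multiple of \<open>n\<close> or not.\<close>

lemma tail_doubling_dilation:
  assumes a: "admissible a" and D: "tail_doubling a"
  shows "\<exists>c>0. \<forall>n m. 1 \<le> n \<longrightarrow> 1 \<le> m \<longrightarrow> m \<le> K * n \<longrightarrow> c * tail a n \<le> tail a m"
proof -
  obtain c where c: "c > 0" "\<And>n. n \<ge> 1 \<Longrightarrow> c * tail a n \<le> tail a (2 * n)"
    using D unfolding tail_doubling_def by blast
  have pow: "c ^ p * tail a n \<le> tail a (2 ^ p * n)" if "n \<ge> 1" for p n
  proof (induction p)
    case (Suc p)
    have "c ^ Suc p * tail a n \<le> c * tail a (2 ^ p * n)"
      using mult_left_mono[OF Suc, of c] c(1) by (simp add: mult_ac)
    also have "\<dots> \<le> tail a (2 * (2 ^ p * n))"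
      using that by (intro c(2)) simp
    finally show ?case by (simp add: mult_ac)
  qed simp
  have "c ^ K * tail a n \<le> tail a m" if "1 \<le> n" "1 \<le> m" "m \<le> K * n" for n m
  proof -
    have "m \<le> 2 ^ K * n"
      using that(3) less_exp[of K] by (meson le_trans less_imp_le mult_le_mono1)
    then show ?thesis
      using pow[OF that(1), of K] tail_antimono[OF a that(2)] by fastforce
  qed
  then show ?thesis using c(1) by (intro exI[of _ "c ^ K"]) auto
qed

lemma weak_tail_equivalent_sym: "weak_tail_equivalent a b \<Longrightarrow> weak_tail_equivalent b a"
  unfolding weak_tail_equivalent_def by blast

lemma weak_tail_equivalent_refl: "weak_tail_equivalent a a"
  unfolding weak_tail_equivalent_def by (intro exI[of _ 1]) auto

text \<open>Doubling of the tails of \<open>a\<close> undoes both dilations. The lower bound is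
  immediate; the upper bound controls \<open>tail b\<close> only at multiples of \<open>k\<close>,
  so \<open>n\<close> has to be rounded down to such a multiple.\<close>

lemma weak_tail_equivalent_bounds:
  assumes a: "admissible a" and b: "admissible b"
    and w: "weak_tail_equivalent b a" and D: "tail_doubling a"
  shows "\<exists>c>0. \<exists>C>0. \<forall>n\<ge>1. c * tail a n \<le> tail b n \<and> tail b n \<le> C * tail a n"
proof -
  obtain j k where jk: "j \<ge> 1" "k \<ge> 1"
    and j: "\<And>n. n \<ge> 1 \<Longrightarrow> tail a (j * n) / real j \<le> tail b n"
    and k: "\<And>n. n \<ge> 1 \<Longrightarrow> tail b (k * n) / real k \<le> tail a n"
    using w unfolding weak_tail_equivalent_def by blast
  obtain c where c: "c > 0"
    "\<And>n m. 1 \<le> n \<Longrightarrow> 1 \<le> m \<Longrightarrow> m \<le> j * n \<Longrightarrow> c * tail a n \<le> tail a m"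
    using tail_doubling_dilation[OF a D, of j] by blast
  obtain d where d: "d > 0"
    "\<And>n m. 1 \<le> n \<Longrightarrow> 1 \<le> m \<Longrightarrow> m \<le> 2 * k * n \<Longrightarrow> d * tail a n \<le> tail a m"
    using tail_doubling_dilation[OF a D, of "2 * k"] by blast
  \<comment> \<open>The first entry serves \<open>n \<ge> k\<close>. The second serves the finitely
    many \<open>n < k\<close>, which have no positive multiple of \<open>k\<close> below
    them.\<close>
  define C where "C = max (real k / d) (tail b 1 / tail a k)"
  have "c / real j * tail a n \<le> tail b n" if n: "n \<ge> 1" for n
  proof -
    have "c * tail a n / real j \<le> tail a (j * n) / real j"
      using c(2)[of n "j * n"] n jk by (intro divide_right_mono) auto
    then show ?thesis using j[OF n] by simp
  qed
  moreover have "tail b n \<le> C * tail a n" if n: "n \<ge> 1" for n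
  proof (cases "n < k")
    case True
    have "tail b n \<le> tail b 1" using tail_antimono[OF b _ n] by simp
    also have "\<dots> = tail b 1 / tail a k * tail a k"
      using tail_pos[OF a jk(2)] by simp
    also have "\<dots> \<le> tail b 1 / tail a k * tail a n"
      using tail_antimono[OF a n, of k] True tail_pos[OF b, of 1] tail_pos[OF a jk(2)]
      by (intro mult_left_mono) auto
    also have "\<dots> \<le> C * tail a n"
      using tail_pos[OF a n] by (intro mult_right_mono) (auto simp: C_def)
    finally show ?thesis .
  next
    case False
    \<comment> \<open>The hypothesis compares \<open>tail b (k * q)\<close> with
      \<open>tail a q\<close>. As \<open>q \<ge> 1\<close>, the remainder is less than
      \<open>k * q\<close>, so \<open>n \<le> 2 * k * q\<close> and \<open>tail a q\<close> is
      controlled by \<open>tail a n\<close>.\<close>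
    define q where "q = n div k"
    have q: "q \<ge> 1" using False jk by (simp add: q_def div_greater_zero_iff Suc_leI)
    have n_eq: "n = k * q + n mod k" by (simp add: q_def)
    have "n mod k < k" using jk by simp
    also have "k \<le> k * q" using q by simp
    finally have "n \<le> 2 * k * q" using n_eq by linarith
    then have dn: "d * tail a q \<le> tail a n" using d(2) q n by blast
    have "tail b n \<le> tail b (k * q)"
      using q jk n_eq by (intro tail_antimono[OF b]) auto
    also have "\<dots> \<le> real k * tail a q"
      using k[OF q] jk by (simp add: field_simps)
    also have "\<dots> = real k / d * (d * tail a q)" using d(1) by simp
    also have "\<dots> \<le> real k / d * tail a n"
      using dn d(1) by (intro mult_left_mono) auto
    also have "\<dots> \<le> C * tail a n"
      using tail_pos[OF a n] by (intro mult_right_mono) (auto simp: C_def)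
    finally show ?thesis .
  qed
  moreover have "c / real j > 0" "C > 0" using c(1) jk d(1) by (auto simp: C_def less_max_iff_disj)
  ultimately show ?thesis by blast
qed

lemma weak_imp_tail_equivalent:
  assumes "admissible a" "admissible b" "weak_tail_equivalent b a" "tail_doubling a"
  shows "tail_equivalent b a"
proof -
  obtain c C where "c > 0" "C > 0"
    "\<And>n. n \<ge> 1 \<Longrightarrow> c * tail a n \<le> tail b n \<and> tail b n \<le> C * tail a n"
    using weak_tail_equivalent_bounds[OF assms] by blast
  then show ?thesis
    unfolding tail_equivalent_def seq_equiv_on_def
    using tail_pos[OF assms(1)] by (intro exI[of _ c] conjI exI[of _ C]) (auto simp: field_simps)
qed

text \<open>Pass from \<open>b\<close> to \<open>a\<close> (cost \<open>C\<close>), double the index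
  there (cost \<open>d\<close>), and pass back (cost \<open>c\<close>).\<close>

lemma tail_doubling_weak_tail_equivalent:
  assumes a: "admissible a" and b: "admissible b"
    and w: "weak_tail_equivalent b a" and D: "tail_doubling a"
  shows "tail_doubling b"
proof -
  obtain c C where c: "c > 0" "C > 0"
    "\<And>n. n \<ge> 1 \<Longrightarrow> c * tail a n \<le> tail b n" "\<And>n. n \<ge> 1 \<Longrightarrow> tail b n \<le> C * tail a n"
    using weak_tail_equivalent_bounds[OF assms] by blast
  obtain d where d: "d > 0" "\<And>n. n \<ge> 1 \<Longrightarrow> d * tail a n \<le> tail a (2 * n)"
    using D unfolding tail_doubling_def by blast
  have "c * d / C * tail b n \<le> tail b (2 * n)" if n: "n \<ge> 1" for n
  proof -
    have "c * d / C * tail b n \<le> c * d / C * (C * tail a n)"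
      using c(1,2,4) d(1) n by (intro mult_left_mono) auto
    also have "\<dots> = c * (d * tail a n)" using c(2) by simp
    also have "\<dots> \<le> c * tail a (2 * n)" using c(1) d(2)[OF n] by (intro mult_left_mono) auto
    also have "\<dots> \<le> tail b (2 * n)" using n by (intro c(3)) auto
    finally show ?thesis .
  qed
  then show ?thesis
    unfolding tail_doubling_def using c d by (intro exI[of _ "c * d / C"]) auto
qed

section \<open>The sequence of paired terms\<close>

text \<open>Grouping the series from the even index \<open>2 * n\<close> on into consecutive pairs;
  this identifies the tails of the test sequence below.\<close>

lemma pair_sums:
  assumes a: "admissible a"
  shows "(\<lambda>j. a (2 * (n + j)) + a (2 * (n + j) + 1)) sums tail a (2 * n)"
proof -
  have "summable (\<lambda>j. a (2 * n + j))"
    using a summable_ignore_initial_segment[of a "2 * n"] by (simp add: admissible_def add.commute)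
  then have "(\<lambda>j. a (2 * n + j)) sums tail a (2 * n)"
    unfolding tail_def by (rule summable_sums)
  from sums_group[OF this, of 2] show ?thesis
    by (simp add: numeral_2_eq_2 sum.atLeastLessThan_Suc algebra_simps)
qed

lemma tail_equivalent_class_imp_tail_doubling:
  assumes a: "admissible a" and T: "\<And>b. b \<in> weak_tail_class a \<Longrightarrow> tail_equivalent b a"
  shows "tail_doubling a"
proof -
  define b where "b n = a (2 * n) + a (2 * n + 1)" for n
  have tb: "tail b n = tail a (2 * n)" for n
    using sums_unique[OF pair_sums[OF a, of n]] by (simp add: tail_def[of b] b_def)
  have sb: "summable b"
    using sums_summable[OF pair_sums[OF a, of 0]] by (simp add: b_def[abs_def])
  have "a (Suc (Suc m)) \<le> a m" if "m \<ge> 1" for m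
    using a that unfolding admissible_def by (meson le_SucI order_trans)
  from this[of "2 * n" for n] this[of "2 * n + 1" for n] have "b (Suc n) \<le> b n" if "n \<ge> 1" for n
    using that by (auto simp: b_def intro!: add_mono)
  moreover have "b n > 0" if "n \<ge> 1" for n
    using a that by (auto simp: b_def admissible_def intro!: add_pos_pos)
  ultimately have "admissible b" using sb by (auto simp: admissible_def)
  \<comment> \<open>The factors 2 and 1 work: the first inequality becomes
    \<open>tail a (2 * n) / 2 \<le> tail a (2 * n)\<close>, the second is monotonicity of
    tails.\<close>
  moreover have "weak_tail_equivalent b a"
    unfolding weak_tail_equivalent_def
  proof (rule exI[of _ 2], intro conjI exI[of _ 1] allI impI)
    fix n :: nat assume n: "n \<ge> 1"
    show "tail a (2 * n) / real 2 \<le> tail b n"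
      using tail_pos[OF a, of "2 * n"] n by (simp add: tb)
    show "tail b (1 * n) / real 1 \<le> tail a n"
      using tail_antimono[OF a n, of "2 * n"] by (simp add: tb)
  qed auto
  ultimately have "tail_equivalent b a" using T by (simp add: weak_tail_class_def)
  then obtain c where "c > 0" "\<And>n. n \<ge> 1 \<Longrightarrow> c \<le> tail a (2 * n) / tail a n"
    unfolding tail_equivalent_def seq_equiv_on_def tb by auto
  then show ?thesis
    unfolding tail_doubling_def using tail_pos[OF a] by (auto simp: field_simps)
qed

section \<open>Associated functions and their inverses\<close>

text \<open>The numerator is bounded by \<open>tail a 1\<close>. This places the quotients inside
  the domain of \<open>h\<close> from some index on, and below any given point.\<close>

lemma tail_quotient_small:
  assumes a: "admissible a" and e: "e > 0"
  shows "\<exists>N\<ge>1. \<forall>n\<ge>N. tail a n / real n < e"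
proof -
  obtain N :: nat where N: "tail a 1 / e < real N" using reals_Archimedean2 by blast
  have "tail a n / real n < e" if n: "n \<ge> max 1 N" for n
  proof -
    have "tail a n \<le> tail a 1" using tail_antimono[OF a, of 1 n] n by simp
    also have "\<dots> < e * real N" using N e by (simp add: field_simps)
    also have "\<dots> \<le> e * real n" using n e by (intro mult_left_mono) auto
    finally show ?thesis using n by (simp add: field_simps)
  qed
  then show ?thesis by (intro exI[of _ "max 1 N"]) auto
qed

lemma associated_bounds:
  assumes "associated a A h"
  obtains c1 c2 where "c1 > 0" "c2 > 0"
    "\<And>n. n \<ge> 1 \<Longrightarrow> tail a n / real n \<le> A \<Longrightarrow> c1 / real n \<le> h (tail a n / real n)"
    "\<And>n. n \<ge> 1 \<Longrightarrow> tail a n / real n \<le> A \<Longrightarrow> h (tail a n / real n) \<le> c2 / real n"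
proof -
  obtain c1 c2 where "c1 > 0" "c2 > 0"
    "\<And>n. n \<ge> 1 \<Longrightarrow> tail a n / real n \<le> A \<Longrightarrow>
       c1 \<le> h (tail a n / real n) * real n \<and> h (tail a n / real n) * real n \<le> c2"
    using assms unfolding associated_def seq_equiv_on_def by auto
  then show ?thesis using that[of c1 c2] by (auto simp: divide_le_eq le_divide_eq)
qed

lemma associated_le_iff:
  assumes "associated a A h" "0 < x" "x \<le> A" "0 < y" "y \<le> A"
  shows "h x \<le> h y \<longleftrightarrow> x \<le> y"
  using assms strict_mono_on_less_eq[of "{0<..A}" h x y] by (auto simp: associated_def)

lemma associated_pos:
  assumes "associated a A h" "0 < x" "x \<le> A"
  shows "h x > 0"
  using assms unfolding associated_def by (auto simp: image_subset_iff)

text \<open>Association forces \<open>h\<close> to take arbitrarily small values, since it is at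
  most \<open>c2 / n\<close> at \<open>tail a n / n\<close>; the intermediate value theorem gives
  everything up to \<open>h A\<close>.\<close>

lemma associated_surj:
  assumes a: "admissible a" and h: "associated a A h" and y: "0 < y" "y \<le> h A"
  obtains x where "0 < x" "x \<le> A" "h x = y"
proof -
  have A: "A > 0" "continuous_on {0<..A} h" using h by (auto simp: associated_def)
  obtain c1 c2 where c: "c2 > 0"
    "\<And>n. n \<ge> 1 \<Longrightarrow> tail a n / real n \<le> A \<Longrightarrow> h (tail a n / real n) \<le> c2 / real n"
    using associated_bounds[OF h] by metis
  obtain N where N: "N \<ge> 1" "\<And>n. n \<ge> N \<Longrightarrow> tail a n / real n < A"
    using tail_quotient_small[OF a A(1)] by blast
  obtain M :: nat where M: "c2 / y < real M" using reals_Archimedean2 by blast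
  define n where "n = max N M"
  define s where "s = tail a n / real n"
  have n: "n \<ge> 1" "n \<ge> N" "n \<ge> M" using N by (auto simp: n_def)
  have s: "s > 0" "s < A" using tail_pos[OF a n(1)] n N(2) by (auto simp: s_def)
  have "c2 < y * real M" using M y by (simp add: field_simps)
  also have "\<dots> \<le> y * real n" using n y by (intro mult_left_mono) auto
  finally have "c2 / real n \<le> y" using n by (simp add: field_simps)
  then have "h s \<le> y" using c(2)[OF n(1)] s by (simp add: s_def)
  moreover have "continuous_on {s..A} h"
    using s by (intro continuous_on_subset[OF A(2)]) auto
  ultimately obtain x where "s \<le> x" "x \<le> A" "h x = y"
    using IVT'[of h s y A] y s by auto
  then show ?thesis using that[of x] s by auto
qed

text \<open>Substituting \<open>u = h x\<close> and \<open>2 * u = h y\<close> eliminates the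
  inverse; surjectivity of \<open>h\<close> ensures that no \<open>u\<close> is lost.\<close>

lemma inverse_doubling_iff:
  assumes a: "admissible a" and h: "associated a A h"
  shows "inverse_doubling A h \<longleftrightarrow>
    (\<exists>\<tau>>0. \<forall>x y. 0 < x \<longrightarrow> x \<le> A \<longrightarrow> 0 < y \<longrightarrow> y \<le> A \<longrightarrow> h y = 2 * h x \<longrightarrow> \<tau> * y \<le> x)"
    (is "_ \<longleftrightarrow> (\<exists>\<tau>>0. ?P \<tau>)")
proof -
  have A: "A > 0" and inj: "inj_on h {0<..A}"
    using h strict_mono_on_imp_inj_on by (auto simp: associated_def)
  define g where "g = the_inv_into {0<..A} h"
  have gh: "g (h x) = x" if "0 < x" "x \<le> A" for x
    using the_inv_into_f_f[OF inj] that by (simp add: g_def)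
  have hA: "h x \<le> h A" if "0 < x" "x \<le> A" for x
    using that associated_le_iff[OF h, of x A] by auto
  have "(\<forall>u. u \<in> {0<..h A} \<and> 2 * u \<in> {0<..h A} \<longrightarrow> \<tau> * g (2 * u) \<le> g u) \<longleftrightarrow> ?P \<tau>"
    (is "?L \<longleftrightarrow> _") for \<tau>
  proof (intro iffI allI impI)
    fix x y assume L: ?L and xy: "0 < x" "x \<le> A" "0 < y" "y \<le> A" "h y = 2 * h x"
    then show "\<tau> * y \<le> x"
      using L[rule_format, of "h x"] associated_pos[OF h xy(1,2)] hA[OF xy(1,2)] hA[OF xy(3,4)]
        gh[OF xy(1,2)] gh[OF xy(3,4)] by simp
  next
    fix u assume P: "?P \<tau>" and u: "u \<in> {0<..h A} \<and> 2 * u \<in> {0<..h A}"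
    obtain x where x: "0 < x" "x \<le> A" "h x = u" using associated_surj[OF a h, of u] u by auto
    obtain y where y: "0 < y" "y \<le> A" "h y = 2 * u" using associated_surj[OF a h, of "2 * u"] u by auto
    show "\<tau> * g (2 * u) \<le> g u" using P x y gh[OF x(1,2)] gh[OF y(1,2)] by auto
  qed
  then show ?thesis unfolding inverse_doubling_def doubling_def g_def[symmetric] by blast
qed

section \<open>Doubling of the inverse against doubling of the tails\<close>

text \<open>The values of \<open>h\<close> at the quotients for \<open>n\<close> and
  \<open>2 * n\<close> differ by a bounded factor, so boundedly many halvings of the value lead from
  one argument to the other, each costing a factor \<open>\<tau>\<close>.\<close>

lemma inverse_doubling_imp_tail_doubling:
  assumes a: "admissible a" and h: "associated a A h" and I: "inverse_doubling A h"
  shows "tail_doubling a"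
proof -
  have A: "A > 0" using h by (auto simp: associated_def)
  obtain \<tau> where \<tau>: "\<tau> > 0"
    "\<And>x y. 0 < x \<Longrightarrow> x \<le> A \<Longrightarrow> 0 < y \<Longrightarrow> y \<le> A \<Longrightarrow> h y = 2 * h x \<Longrightarrow> \<tau> * y \<le> x"
    using I unfolding inverse_doubling_iff[OF a h] by blast
  have pow: "\<tau> ^ p * y \<le> x" if "0 < x" "x \<le> A" "0 < y" "y \<le> A" "h y \<le> 2 ^ p * h x" for x y p
    using that(3-)
  proof (induction p arbitrary: y)
    case 0
    then show ?case using associated_le_iff[OF h, of y x] that(1,2) by simp
  next
    case (Suc p)
    have "h y \<le> h A" "h y > 0"
      using Suc.prems associated_le_iff[OF h, of y A] associated_pos[OF h] by auto
    then obtain z where z: "0 < z" "z \<le> A" "h z = h y / 2"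
      using associated_surj[OF a h, of "h y / 2"] by auto
    have "\<tau> ^ Suc p * y = \<tau> ^ p * (\<tau> * y)" by simp
    also have "\<dots> \<le> \<tau> ^ p * z" using \<tau>(1) \<tau>(2)[of z y] z Suc.prems by (intro mult_left_mono) auto
    also have "\<dots> \<le> x" using Suc.prems z by (intro Suc.IH) auto
    finally show ?case .
  qed
  obtain c1 c2 where c: "c1 > 0" "c2 > 0"
    "\<And>n. n \<ge> 1 \<Longrightarrow> tail a n / real n \<le> A \<Longrightarrow> c1 / real n \<le> h (tail a n / real n)"
    "\<And>n. n \<ge> 1 \<Longrightarrow> tail a n / real n \<le> A \<Longrightarrow> h (tail a n / real n) \<le> c2 / real n"
    using associated_bounds[OF h] by metis
  \<comment> \<open>\<open>2 * c2 / c1\<close> is the ratio of the upper bound \<open>c2 / n\<close>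
    to the lower bound \<open>c1 / (2 * n)\<close>.\<close>
  obtain p where p: "2 * c2 / c1 < 2 ^ p" using real_arch_pow[of 2] by auto
  obtain N where N: "N \<ge> 1" "\<And>n. n \<ge> N \<Longrightarrow> tail a n / real n < A"
    using tail_quotient_small[OF a A] by blast
  \<comment> \<open>The second entry handles the indices \<open>n < N\<close>, whose quotients may
    lie outside the domain of \<open>h\<close>.\<close>
  define d where "d = min (\<tau> ^ p) (tail a (2 * N) / tail a 1)"
  have dpos: "d > 0" using \<tau>(1) tail_pos[OF a] N(1) by (simp add: d_def)
  have "d * tail a n \<le> tail a (2 * n)" if n: "n \<ge> 1" for n
  proof (cases "n \<ge> N")
    case True
    have s: "tail a n / real n < A" "tail a (2 * n) / real (2 * n) < A"
      using N(2)[of n] N(2)[of "2 * n"] True by auto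
    have "h (tail a n / real n) \<le> c2 / real n" using c(4)[OF n] s by simp
    also have "\<dots> = 2 * c2 / c1 * (c1 / real (2 * n))" using c(1) n by (simp add: field_simps)
    also have "\<dots> \<le> 2 ^ p * h (tail a (2 * n) / real (2 * n))"
      using c(3)[of "2 * n"] s n c(1,2) p by (intro mult_mono) auto
    finally have "\<tau> ^ p * (tail a n / real n) \<le> tail a (2 * n) / real (2 * n)"
      using s n tail_pos[OF a, of n] tail_pos[OF a, of "2 * n"] by (intro pow) auto
    then have "2 * (\<tau> ^ p * tail a n) \<le> tail a (2 * n)" using n by (simp add: field_simps)
    moreover have "d * tail a n \<le> \<tau> ^ p * tail a n"
      using tail_pos[OF a n] by (intro mult_right_mono) (auto simp: d_def)
    moreover have "0 < d * tail a n" using dpos tail_pos[OF a n] by simp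
    ultimately show ?thesis by linarith
  next
    case False
    have "d * tail a n \<le> tail a (2 * N) / tail a 1 * tail a 1"
      using tail_antimono[OF a, of 1 n] tail_pos[OF a, of 1] tail_pos[OF a, of n]
        tail_pos[OF a, of "2 * N"] N(1) n
      by (intro mult_mono) (auto simp: d_def)
    also have "\<dots> = tail a (2 * N)" using tail_pos[OF a, of 1] by simp
    also have "\<dots> \<le> tail a (2 * n)" using False n by (intro tail_antimono[OF a]) auto
    finally show ?thesis .
  qed
  then show ?thesis unfolding tail_doubling_def using dpos by blast
qed

text \<open>Bracket \<open>y\<close> between consecutive quotients
  \<open>s (Suc n) < y \<le> s n\<close>. Multiplying the index by a fixed \<open>K\<close> pushes
  \<open>h\<close> below \<open>h y / 2\<close>, hence the quotient below \<open>x\<close>, while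
  doubling tails keep that quotient comparable to \<open>s n\<close>.\<close>

lemma tail_doubling_imp_inverse_doubling:
  assumes a: "admissible a" and h: "associated a A h" and D: "tail_doubling a"
  shows "inverse_doubling A h"
proof -
  have A: "A > 0" using h by (auto simp: associated_def)
  define s where "s n = tail a n / real n" for n
  have spos: "s n > 0" if "n \<ge> 1" for n using tail_pos[OF a that] that by (simp add: s_def)
  obtain c1 c2 where c: "c1 > 0" "c2 > 0"
    "\<And>n. n \<ge> 1 \<Longrightarrow> s n \<le> A \<Longrightarrow> c1 / real n \<le> h (s n)"
    "\<And>n. n \<ge> 1 \<Longrightarrow> s n \<le> A \<Longrightarrow> h (s n) \<le> c2 / real n"
    using associated_bounds[OF h] unfolding s_def by metis
  obtain N where N: "N \<ge> 1" "\<And>n. n \<ge> N \<Longrightarrow> s n < A"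
    using tail_quotient_small[OF a A] unfolding s_def by blast
  \<comment> \<open>Ensures \<open>c2 / K \<le> c1 / 2\<close>: dilating the index by
    \<open>K\<close> at least halves the value of \<open>h\<close>.\<close>
  obtain K :: nat where K: "2 * c2 / c1 < real K" using reals_Archimedean2 by blast
  have "0 < 2 * c2 / c1" using c(1,2) by simp
  with K have K1: "K \<ge> 1" by (cases K) auto
  obtain d where d: "d > 0"
    "\<And>n m. 1 \<le> n \<Longrightarrow> 1 \<le> m \<Longrightarrow> m \<le> 2 * K * n \<Longrightarrow> d * tail a n \<le> tail a m"
    using tail_doubling_dilation[OF a D, of "2 * K"] by blast
  have "0 < h (s N)" "h (s N) \<le> h A"
    using associated_pos[OF h, of "s N"] associated_le_iff[OF h, of "s N" A] spos N A by (auto simp: less_imp_le)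
  \<comment> \<open>A lower bound for \<open>x\<close> when \<open>y\<close> exceeds
    \<open>s N\<close>, where no bracketing is available: then
    \<open>h x = h y / 2 \<ge> h z\<close>.\<close>
  then obtain z where z: "0 < z" "z \<le> A" "h z = h (s N) / 2"
    using associated_surj[OF a h, of "h (s N) / 2"] by auto
  define \<tau> where "\<tau> = min (d / (2 * real K)) (z / A)"
  have "\<tau> * y \<le> x" if xy: "0 < x" "x \<le> A" "0 < y" "y \<le> A" "h y = 2 * h x" for x y
  proof (cases "y \<le> s N")
    case True
    obtain M where M: "\<And>n. n \<ge> M \<Longrightarrow> s n < y"
      using tail_quotient_small[OF a xy(3)] unfolding s_def by blast
    \<comment> \<open>Otherwise \<open>y \<le> s n\<close> would propagate from \<open>N\<close> to
      all later indices, against the smallness of the quotients.\<close>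
    have "\<exists>n\<ge>N. y \<le> s n \<and> s (Suc n) < y"
    proof (rule ccontr)
      assume *: "\<not> ?thesis"
      have "y \<le> s n" if "n \<ge> N" for n
        using that by (induction rule: dec_induct) (use True * not_less in blast)+
      from this[of "max M N"] M[of "max M N"] show False by simp
    qed
    then obtain n where n: "n \<ge> N" "y \<le> s n" "s (Suc n) < y" by blast
    define m where "m = K * Suc n"
    have m: "m \<ge> N" "m \<ge> 1" "n \<ge> 1" using n N K1 mult_le_mono1[of 1 K "Suc n"] by (auto simp: m_def)
    \<comment> \<open>\<open>Suc n \<le> 2 * n\<close> because \<open>n \<ge> 1\<close>; this is the
      source of the 2 in the choice of \<open>d\<close> and in \<open>\<tau>\<close>.\<close>
    have "m \<le> K * (2 * n)" unfolding m_def using m by (intro mult_le_mono2) auto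
    then have m2: "m \<le> 2 * K * n" by (simp add: mult_ac)
    have "h (s m) \<le> c2 / real m" using c(4)[OF m(2)] N(2)[OF m(1)] by simp
    also have "\<dots> = (c2 / real K) / real (Suc n)" unfolding m_def of_nat_mult by (simp only: divide_divide_eq_left)
    also have "\<dots> \<le> (c1 / 2) / real (Suc n)"
      using K K1 c by (intro divide_right_mono) (auto simp: field_simps)
    also have "\<dots> = (c1 / real (Suc n)) / 2" by simp
    also have "\<dots> \<le> h (s (Suc n)) / 2" using c(3)[of "Suc n"] N(2)[of "Suc n"] n by (intro divide_right_mono) auto
    also have "\<dots> \<le> h y / 2"
      using associated_le_iff[OF h, of "s (Suc n)" y] spos[of "Suc n"] n(3) xy by simp
    finally have "h (s m) \<le> h x" using xy(5) by simp
    then have mx: "s m \<le> x"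
      using associated_le_iff[OF h, of "s m" x] spos[OF m(2)] N(2)[OF m(1)] xy by simp
    have "\<tau> * y \<le> d / (2 * real K) * s n"
      using n(2) xy(3) d(1) by (intro mult_mono) (auto simp: \<tau>_def)
    also have "\<dots> = d * tail a n / real (2 * K * n)" by (simp add: s_def)
    also have "\<dots> \<le> tail a m / real m"
      using d(2)[OF m(3,2) m2] m m2 tail_pos[OF a m(3)] tail_pos[OF a m(2)] d(1) of_nat_mono[OF m2, where 'a = real]
      by (intro frac_le) auto
    finally show ?thesis using mx by (simp add: s_def)
  next
    case False
    then have "h (s N) \<le> h y"
      using associated_le_iff[OF h, of "s N" y] spos[OF N(1)] xy by auto
    then have "z \<le> x" using associated_le_iff[OF h, of z x] z xy by simp
    moreover have "\<tau> * y \<le> z / A * A"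
      using xy z A by (intro mult_mono) (auto simp: \<tau>_def)
    ultimately show ?thesis using A by simp
  qed
  moreover have "\<tau> > 0" using d(1) K1 z A by (simp add: \<tau>_def)
  ultimately show ?thesis unfolding inverse_doubling_iff[OF a h] by blast
qed

theorem theorem4p8:
  fixes a :: "nat \<Rightarrow> real"
    and A :: "(nat \<Rightarrow> real) \<Rightarrow> real"
    and h :: "(nat \<Rightarrow> real) \<Rightarrow> real \<Rightarrow> real"
  assumes "admissible a"
    and "\<And>b. b \<in> weak_tail_class a \<Longrightarrow> associated b (A b) (h b)"
  shows "((\<exists>b\<in>weak_tail_class a. inverse_doubling (A b) (h b)) \<longleftrightarrow>
          (\<forall>b\<in>weak_tail_class a. inverse_doubling (A b) (h b))) \<and>
         ((\<forall>b\<in>weak_tail_class a. inverse_doubling (A b) (h b)) \<longleftrightarrow>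
          (\<forall>b\<in>weak_tail_class a. tail_equivalent b a))"
proof -
  have aW: "a \<in> weak_tail_class a"
    using assms(1) weak_tail_equivalent_refl by (simp add: weak_tail_class_def)
  have W: "admissible b" "weak_tail_equivalent b a" if "b \<in> weak_tail_class a" for b
    using that by (auto simp: weak_tail_class_def)
  \<comment> \<open>The right-hand side does not mention \<open>b\<close>, so the existential and
    universal conditions agree once the class is known to contain \<open>a\<close>.\<close>
  have inv: "inverse_doubling (A b) (h b) \<longleftrightarrow> tail_doubling a" if "b \<in> weak_tail_class a" for b
    using inverse_doubling_imp_tail_doubling tail_doubling_imp_inverse_doubling
      tail_doubling_weak_tail_equivalent weak_tail_equivalent_sym W[OF that] assms(1) assms(2)[OF that]
    by blast
  have "(\<forall>b\<in>weak_tail_class a. tail_equivalent b a) \<longleftrightarrow> tail_doubling a"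
    using tail_equivalent_class_imp_tail_doubling weak_imp_tail_equivalent W assms(1) by blast
  then show ?thesis using inv aW by blast
qed

end
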